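(* Suppose that the value function $J^\star$ is (real-valued and) continuous, inf-compact, and vanishes only at $x^e$. Let $\mu$ be a positive measure on $\mathsf X$ and write $\langle\mu,J\rangle=\int J\,d\mu$. Then the pair $(J^\star,Q^\star)$ solves the following convex program in the variables $(J,Q)$, where $J:\mathsf X\to\mathbb R$ and $Q:\mathsf X\times\mathsf U\to\mathbb R$: $$\begin{aligned}\max_{J,Q}\quad &\langle \mu,J\rangle\\ \text{s.t.}\quad & Q(x,u)\le c(x,u)+J(\mathrm F(x,u)),\qquad x\in\mathsf X,\ u\in\mathsf U(x),\\ & Q(x,u)\ge J(x),\qquad x\in\mathsf X,\ u\in\mathsf U(x),\\ & J\text{ is continuous, and } J(x^e)=0.\end{aligned}$$
   Context: Setting: $\mathsf X$ (state space) and $\mathsf U$ (input space) are Polish spaces, $\mathrm F:\mathsf X\times\mathsf U\to\mathsf X$, and the deterministic control system is $x(k+1)=\mathrm F(x(k),u(k))$, $k\ge 0$, $x(0)\in\mathsf X$. There may be state-dependent constraints: inputs satisfy $u(k)\in\mathsf U(x(k))$, where $\mathsf U(x)\subset\mathsf U$ for each $x$. There is an equilibrium pair $(x^e,u^e)$, $u^e\in\mathsf U(x^e)$, with $x^e=\mathrm F(x^e,u^e)$. The cost function $c:\mathsf X\times\mathsf U\to\mathbb R_+$ is non-negative and $c(x^e,u^e)=0$. The value function is $J^\star(x)=\min_{\boldsymbol u}\sum_{k=0}^\infty c(x(k),u(k))$, $x(0)=x$, the minimum being over all admissible input sequences $\boldsymbol u=\{u(k):k\ge 0\}$ (assumed attained).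 The Q-function is $Q^\star(x,u)=c(x,u)+J^\star(\mathrm F(x,u))$. The Bellman equation is $J^\star(x)=\min_{u\in\mathsf U(x)}Q^\star(x,u)$. A function $J:\mathsf X\to\mathbb R$ is inf-compact if for every scalar $r$ the sub-level set $S_J(r)=\{x\in\mathsf X: J(x)\le r\}$ is either pre-compact, empty, or equal to $\mathsf X$. "Solves" means: $(J^\star,Q^\star)$ is feasible, and $\langle\mu,J\rangle\le\langle\mu,J^\star\rangle$ for every feasible pair $(J,Q)$ for which $\langle\mu,J\rangle$ is well defined. *)

theory Defs
  imports "HOL-Analysis.Analysis"
begin

fun trajectory :: "('x \<Rightarrow> 'u \<Rightarrow> 'x) \<Rightarrow> 'x \<Rightarrow> (nat \<Rightarrow> 'u) \<Rightarrow> nat \<Rightarrow> 'x" where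
  "trajectory F x u 0 = x"
| "trajectory F x u (Suc k) = F (trajectory F x u k) (u k)"

definition admissible_inputs ::
  "('x \<Rightarrow> 'u \<Rightarrow> 'x) \<Rightarrow> ('x \<Rightarrow> 'u set) \<Rightarrow> 'x \<Rightarrow> (nat \<Rightarrow> 'u) set" where
  "admissible_inputs F U x = {u. \<forall>k. u k \<in> U (trajectory F x u k)}"

definition total_cost ::
  "('x \<Rightarrow> 'u \<Rightarrow> 'x) \<Rightarrow> ('x \<Rightarrow> 'u \<Rightarrow> real) \<Rightarrow> 'x \<Rightarrow> (nat \<Rightarrow> 'u) \<Rightarrow> ennreal" where
  "total_cost F c x u = (\<Sum>k. ennreal (c (trajectory F x u k) (u k)))"

text \<open>
  The value is an infimum in the extended non-negative reals, equal to infinity when no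
  admissible input has finite cost (or none exists).  That the infimum is a minimum and that
  it is finite are the separate predicates \<open>value_attained\<close> and \<open>value_finite\<close>.
\<close>

definition ext_value_function ::
  "('x \<Rightarrow> 'u \<Rightarrow> 'x) \<Rightarrow> ('x \<Rightarrow> 'u set) \<Rightarrow> ('x \<Rightarrow> 'u \<Rightarrow> real) \<Rightarrow> 'x \<Rightarrow> ennreal" where
  "ext_value_function F U c x = (INF u\<in>admissible_inputs F U x. total_cost F c x u)"

definition value_attained ::
  "('x \<Rightarrow> 'u \<Rightarrow> 'x) \<Rightarrow> ('x \<Rightarrow> 'u set) \<Rightarrow> ('x \<Rightarrow> 'u \<Rightarrow> real) \<Rightarrow> bool" where
  "value_attained F U c \<longleftrightarrow>
     (\<forall>x. \<exists>u\<in>admissible_inputs F U x. total_cost F c x u = ext_value_function F U c x)"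

definition value_finite ::
  "('x \<Rightarrow> 'u \<Rightarrow> 'x) \<Rightarrow> ('x \<Rightarrow> 'u set) \<Rightarrow> ('x \<Rightarrow> 'u \<Rightarrow> real) \<Rightarrow> bool" where
  "value_finite F U c \<longleftrightarrow> (\<forall>x. ext_value_function F U c x < \<infinity>)"

text \<open>
  Since \<open>enn2real\<close> sends infinity to 0, the two real-valued functions below have their
  intended meaning only under \<open>value_finite\<close>.
\<close>

definition value_function ::
  "('x \<Rightarrow> 'u \<Rightarrow> 'x) \<Rightarrow> ('x \<Rightarrow> 'u set) \<Rightarrow> ('x \<Rightarrow> 'u \<Rightarrow> real) \<Rightarrow> 'x \<Rightarrow> real" where
  "value_function F U c x = enn2real (ext_value_function F U c x)"

definition Q_function ::
  "('x \<Rightarrow> 'u \<Rightarrow> 'x) \<Rightarrow> ('x \<Rightarrow> 'u set) \<Rightarrow> ('x \<Rightarrow> 'u \<Rightarrow> real) \<Rightarrow> 'x \<Rightarrow> 'u \<Rightarrow> real" where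
  "Q_function F U c x u = c x u + value_function F U c (F x u)"

text \<open>Pre-compact is read as relatively compact, i.e. having compact closure.\<close>

definition inf_compact :: "('x::topological_space \<Rightarrow> real) \<Rightarrow> bool" where
  "inf_compact J \<longleftrightarrow>
     (\<forall>r. compact (closure {x. J x \<le> r}) \<or> {x. J x \<le> r} = {} \<or> {x. J x \<le> r} = UNIV)"

text \<open>
  The objective is the integral of the positive part minus that of the negative part, with
  values in the extended reals.  It is well defined when at least one of the two is finite.
  Note that \<open>ennreal\<close> truncates negative reals to 0.
\<close>

definition pairing_well_defined :: "'x measure \<Rightarrow> ('x \<Rightarrow> real) \<Rightarrow> bool" where
  "pairing_well_defined \<mu> J \<longleftrightarrow> J \<in> borel_measurable \<mu> \<and>
     ((\<integral>\<^sup>+x. ennreal (J x) \<partial>\<mu>) < \<infinity> \<or> (\<integral>\<^sup>+x. ennreal (- J x) \<partial>\<mu>) < \<infinity>)"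

definition pairing :: "'x measure \<Rightarrow> ('x \<Rightarrow> real) \<Rightarrow> ereal" where
  "pairing \<mu> J =
     enn2ereal (\<integral>\<^sup>+x. ennreal (J x) \<partial>\<mu>) - enn2ereal (\<integral>\<^sup>+x. ennreal (- J x) \<partial>\<mu>)"

definition feasible ::
  "('x::topological_space \<Rightarrow> 'u \<Rightarrow> 'x) \<Rightarrow> ('x \<Rightarrow> 'u set) \<Rightarrow> ('x \<Rightarrow> 'u \<Rightarrow> real) \<Rightarrow> 'x \<Rightarrow>
    ('x \<Rightarrow> real) \<Rightarrow> ('x \<Rightarrow> 'u \<Rightarrow> real) \<Rightarrow> bool" where
  "feasible F U c xe J Q \<longleftrightarrow>
     (\<forall>x. \<forall>u\<in>U x. Q x u \<le> c x u + J (F x u)) \<and>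
     (\<forall>x. \<forall>u\<in>U x. Q x u \<ge> J x) \<and>
     continuous_on UNIV J \<and> J xe = 0"

lemma feasible_convex:
  assumes "feasible F U c xe J\<^sub>1 Q\<^sub>1" "feasible F U c xe J\<^sub>2 Q\<^sub>2" "0 \<le> s" "0 \<le> t" "s + t = 1"
  shows "feasible F U c xe (\<lambda>x. s * J\<^sub>1 x + t * J\<^sub>2 x) (\<lambda>x u. s * Q\<^sub>1 x u + t * Q\<^sub>2 x u)"
proof -
  have "s * Q\<^sub>1 x u + t * Q\<^sub>2 x u \<le> c x u + (s * J\<^sub>1 (F x u) + t * J\<^sub>2 (F x u))"
    if "u \<in> U x" for x u
  proof -
    have "s * Q\<^sub>1 x u + t * Q\<^sub>2 x u \<le> s * (c x u + J\<^sub>1 (F x u)) + t * (c x u + J\<^sub>2 (F x u))"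
      using assms that by (auto simp: feasible_def intro!: add_mono mult_left_mono)
    also have "\<dots> = (s + t) * c x u + (s * J\<^sub>1 (F x u) + t * J\<^sub>2 (F x u))"
      by (simp add: algebra_simps)
    finally show ?thesis using assms(5) by simp
  qed
  then show ?thesis
    using assms by (auto simp: feasible_def intro!: add_mono mult_left_mono continuous_intros)
qed

definition solves_program ::
  "'x measure \<Rightarrow> ('x::topological_space \<Rightarrow> 'u \<Rightarrow> 'x) \<Rightarrow> ('x \<Rightarrow> 'u set) \<Rightarrow>
    ('x \<Rightarrow> 'u \<Rightarrow> real) \<Rightarrow> 'x \<Rightarrow> ('x \<Rightarrow> real) \<Rightarrow> ('x \<Rightarrow> 'u \<Rightarrow> real) \<Rightarrow> bool" where
  "solves_program \<mu> F U c xe J Q \<longleftrightarrow>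
     feasible F U c xe J Q \<and> pairing_well_defined \<mu> J \<and>
     (\<forall>J' Q'. feasible F U c xe J' Q' \<and> pairing_well_defined \<mu> J' \<longrightarrow>
        pairing \<mu> J' \<le> pairing \<mu> J)"

end

theory Submission
  imports Defs
begin

text \<open>
  Feasibility of \<open>(J\<^sup>\<star>, Q\<^sup>\<star>)\<close> is the inequality half of the Bellman equation: prefixing an
  input sequence by one step gives \<open>J\<^sup>\<star>(x) \<le> c(x,u) + J\<^sup>\<star>(F(x,u))\<close>
  (\<open>ext_value_function_le_step\<close>).

  For optimality, eliminating \<open>Q\<close> from the two constraints on a competitor \<open>(J, Q)\<close> leaves the
  same inequality for \<open>J\<close>; summing it along a trajectory yields
  \<open>J(x) \<le> c(x(0),u(0)) + \<dots> + c(x(n-1),u(n-1)) + J(x(n))\<close> (\<open>feasible_le_partial_cost\<close>).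
  Taken along an optimal trajectory, the partial sums converge to \<open>J\<^sup>\<star>(x)\<close>, so everything hinges on
  \<open>J(x(n)) \<rightarrow> 0\<close>.  As \<open>J\<close> is only known to be continuous with \<open>J(x\<^sup>e) = 0\<close>, this requires
  \<open>x(n) \<rightarrow> x\<^sup>e\<close>.  The value \<open>J\<^sup>\<star>(x(n))\<close> is at most the remaining cost, hence tends to zero
  (\<open>value_along_optimal_tendsto_zero\<close>), and inf-compactness turns this into convergence of the
  states (\<open>tendsto_of_inf_compact\<close>).  Thus \<open>J \<le> J\<^sup>\<star>\<close> pointwise, and the objective is monotone.
\<close>

lemma trajectory_shift:
  "trajectory F (trajectory F x u n) (\<lambda>k. u (k + n)) k = trajectory F x u (k + n)"
  by (induction k) auto

lemma trajectory_prefix: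
  "trajectory F x (case_nat a u) (Suc k) = trajectory F (F x a) u k"
  by (induction k) auto

lemma admissible_inputs_shift:
  assumes "u \<in> admissible_inputs F U x"
  shows "(\<lambda>k. u (k + n)) \<in> admissible_inputs F U (trajectory F x u n)"
  using assms by (simp add: admissible_inputs_def trajectory_shift)

lemma admissible_inputs_prefix:
  assumes "a \<in> U x" "u \<in> admissible_inputs F U (F x a)"
  shows "case_nat a u \<in> admissible_inputs F U x"
proof -
  have "case_nat a u k \<in> U (trajectory F x (case_nat a u) k)" for k
    using assms trajectory_prefix[of F x a u]
    by (cases k) (auto simp: admissible_inputs_def simp del: trajectory.simps(2))
  then show ?thesis
    by (simp add: admissible_inputs_def)
qed

lemma total_cost_prefix:
  "total_cost F c x (case_nat a u) = ennreal (c x a) + total_cost F c (F x a) u"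
proof -
  let ?f = "\<lambda>k. ennreal (c (trajectory F x (case_nat a u) k) (case_nat a u k))"
  have "suminf ?f = (\<Sum>k. ?f (k + 1)) + sum ?f {..<1}"
    by (rule suminf_offset) simp
  moreover have "?f (k + 1) = ennreal (c (trajectory F (F x a) u k) (u k))" for k
    using trajectory_prefix[of F x a u k] by (simp del: trajectory.simps(2))
  ultimately show ?thesis
    by (simp add: total_cost_def add.commute)
qed

lemma ext_value_function_le_step:
  assumes "a \<in> U x"
  shows "ext_value_function F U c x \<le> ennreal (c x a) + ext_value_function F U c (F x a)"
proof -
  have "ext_value_function F U c x \<le> ennreal (c x a) + total_cost F c (F x a) u"
    if "u \<in> admissible_inputs F U (F x a)" for u
    unfolding ext_value_function_def total_cost_prefix[symmetric]
    using assms that by (intro INF_lower admissible_inputs_prefix)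
  then have "ext_value_function F U c x - ennreal (c x a) \<le> ext_value_function F U c (F x a)"
    unfolding ext_value_function_def[of F U c "F x a"]
    by (intro INF_greatest) (simp add: ennreal_minus_le_iff)
  then show ?thesis
    by (simp add: ennreal_minus_le_iff)
qed

lemma value_function_le_Q_function:
  assumes "c x a \<ge> 0" "value_finite F U c" "a \<in> U x"
  shows "value_function F U c x \<le> Q_function F U c x a"
proof -
  let ?V = "ext_value_function F U c"
  have fin: "?V y < top" for y
    using assms(2) by (simp add: value_finite_def)
  have "enn2real (?V x) \<le> enn2real (ennreal (c x a) + ?V (F x a))"
    using ext_value_function_le_step[of a U x F c] assms(3) fin by (intro enn2real_mono) auto
  also have "\<dots> = c x a + enn2real (?V (F x a))"
    using fin assms(1) by (subst enn2real_plus) auto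
  finally show ?thesis
    by (simp add: Q_function_def value_function_def)
qed

lemma optimal_cost_sums_value_function:
  assumes "\<And>x u. c x u \<ge> 0" "value_finite F U c"
    and "total_cost F c x u = ext_value_function F U c x"
  shows "(\<lambda>k. c (trajectory F x u k) (u k)) sums value_function F U c x"
proof -
  let ?a = "\<lambda>k. c (trajectory F x u k) (u k)"
  have "(\<Sum>k. ennreal (?a k)) \<noteq> top"
    using assms by (simp add: total_cost_def value_finite_def less_top[symmetric])
  with assms(1) have summable: "summable ?a"
    by (intro summable_suminf_not_top)
  with assms(1) have "total_cost F c x u = ennreal (suminf ?a)"
    unfolding total_cost_def by (intro suminf_ennreal2)
  then have "value_function F U c x = suminf ?a"
    using assms(1) summable unfolding value_function_def assms(3)[symmetric]
    by (simp add: suminf_nonneg)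
  with summable show ?thesis
    by (simp add: sums_iff)
qed

text \<open>
  The shifted inputs are admissible from \<open>x(n)\<close>, so the value there is bounded by the tail of a
  convergent series.
\<close>

lemma value_along_optimal_tendsto_zero:
  assumes nonneg: "\<And>x u. c x u \<ge> 0" and fin: "value_finite F U c"
    and adm: "u \<in> admissible_inputs F U x"
    and opt: "total_cost F c x u = ext_value_function F U c x"
  shows "(\<lambda>n. value_function F U c (trajectory F x u n)) \<longlonglongrightarrow> 0"
proof -
  let ?a = "\<lambda>k. c (trajectory F x u k) (u k)"
  have summable: "summable ?a"
    using optimal_cost_sums_value_function[OF nonneg fin opt] by (rule sums_summable)
  have "value_function F U c (trajectory F x u n) \<le> (\<Sum>k. ?a (k + n))" for n
  proof -
    have summable_tail: "summable (\<lambda>k. ?a (k + n))"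
      using summable by (rule summable_ignore_initial_segment)
    have "ext_value_function F U c (trajectory F x u n)
        \<le> total_cost F c (trajectory F x u n) (\<lambda>k. u (k + n))"
      unfolding ext_value_function_def by (intro INF_lower admissible_inputs_shift adm)
    also have "\<dots> = ennreal (\<Sum>k. ?a (k + n))"
      unfolding total_cost_def trajectory_shift
      using nonneg summable_tail by (intro suminf_ennreal2)
    finally show ?thesis
      unfolding value_function_def
      using nonneg summable_tail by (intro enn2real_leI suminf_nonneg)
  qed
  then show ?thesis
    by (intro tendsto_sandwich[OF _ _ tendsto_const suminf_exist_split2[OF summable]]
        always_eventually allI) (simp_all add: value_function_def)
qed

text \<open>
  Outside a neighbourhood of \<open>xe\<close>, a compact sub-level set of \<open>V\<close> leaves a compact set on which
  \<open>V\<close> is bounded below by a positive constant.  Such a sub-level set exists at a positive level as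
  soon as \<open>V\<close> is not identically zero.
\<close>

lemma tendsto_of_inf_compact:
  fixes V :: "'x::topological_space \<Rightarrow> real"
  assumes cont: "continuous_on UNIV V" and inf_compact: "inf_compact V"
    and nonneg: "\<And>x. V x \<ge> 0" and zero: "\<And>x. V x = 0 \<longleftrightarrow> x = xe"
    and lim: "((\<lambda>n. V (X n)) \<longlongrightarrow> 0) G"
  shows "(X \<longlongrightarrow> xe) G"
proof (cases "\<exists>y. y \<noteq> xe")
  case False
  then have "X = (\<lambda>_. xe)" by auto
  then show ?thesis by simp
next
  case True
  then obtain y where "y \<noteq> xe" by blast
  (* Half the value at y: a positive level whose sub-level set omits y, hence is not the space. *)
  define r where "r = V y / 2"
  have "V y > 0"
    using \<open>y \<noteq> xe\<close> nonneg[of y] zero[of y] by linarith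
  then have r: "0 < r" "r < V y"
    by (simp_all add: r_def)
  have closed: "closed {x. V x \<le> r}"
    by (intro closed_Collect_le cont continuous_on_const)
  have "xe \<in> {x. V x \<le> r}" "y \<notin> {x. V x \<le> r}"
    using r zero[of xe] by auto
  then have "{x. V x \<le> r} \<noteq> {}" "{x. V x \<le> r} \<noteq> UNIV"
    by blast+
  with inf_compact closed have compact: "compact {x. V x \<le> r}"
    unfolding inf_compact_def by (metis closure_closed)
  show ?thesis
  proof (rule topological_tendstoI)
    fix W assume W: "open W" "xe \<in> W"
    have "compact ({x. V x \<le> r} \<inter> (- W))"
      using compact W by (intro compact_Int_closed) auto
    have "\<exists>m>0. \<forall>x\<in>{x. V x \<le> r} \<inter> (- W). m \<le> V x"
    proof (cases "{x. V x \<le> r} \<inter> (- W) = {}")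
      case True
      then show ?thesis by (intro exI[of _ 1]) auto
    next
      case False
      then obtain z where z: "z \<in> {x. V x \<le> r} \<inter> (- W)"
          "\<forall>x\<in>{x. V x \<le> r} \<inter> (- W). V z \<le> V x"
        using continuous_attains_inf[OF \<open>compact ({x. V x \<le> r} \<inter> (- W))\<close> False]
          continuous_on_subset[OF cont] by blast
      then have "V z > 0"
        using W nonneg[of z] zero[of z] by (metis ComplD Int_iff order_le_less)
      with z show ?thesis by blast
    qed
    then obtain m where m: "m > 0" "\<And>x. V x \<le> r \<Longrightarrow> x \<notin> W \<Longrightarrow> m \<le> V x"
      by auto
    have "\<forall>\<^sub>F n in G. V (X n) < min r m"
      using lim r m by (intro order_tendstoD(2)) auto
    then show "\<forall>\<^sub>F n in G. X n \<in> W"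
      by eventually_elim (use m(2) in force)
  qed
qed

text \<open>Telescoping of \<open>J(x) \<le> c(x,u) + J(F(x,u))\<close>, from which \<open>Q\<close> has been eliminated.\<close>

lemma feasible_le_partial_cost:
  assumes "feasible F U c xe J Q" "u \<in> admissible_inputs F U x"
  shows "J x \<le> (\<Sum>k<n. c (trajectory F x u k) (u k)) + J (trajectory F x u n)"
proof (induction n)
  case 0
  show ?case by simp
next
  case (Suc n)
  have "u n \<in> U (trajectory F x u n)"
    using assms(2) by (simp add: admissible_inputs_def)
  then have "J (trajectory F x u n)
      \<le> c (trajectory F x u n) (u n) + J (trajectory F x u (Suc n))"
    using assms(1) unfolding feasible_def trajectory.simps by (meson order_trans)
  with Suc.IH show ?case by simp
qed

lemma feasible_le_value_function:
  fixes F :: "'x::topological_space \<Rightarrow> 'u \<Rightarrow> 'x"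
  assumes nonneg: "\<And>x u. c x u \<ge> 0"
    and att: "value_attained F U c" and fin: "value_finite F U c"
    and cont: "continuous_on UNIV (value_function F U c)"
    and inf_compact: "inf_compact (value_function F U c)"
    and zero: "\<And>x. value_function F U c x = 0 \<longleftrightarrow> x = xe"
    and feas: "feasible F U c xe J Q"
  shows "J x \<le> value_function F U c x"
proof -
  obtain u where adm: "u \<in> admissible_inputs F U x"
    and opt: "total_cost F c x u = ext_value_function F U c x"
    using att by (auto simp: value_attained_def)
  have "value_function F U c y \<ge> 0" for y
    by (simp add: value_function_def)
  then have "trajectory F x u \<longlonglongrightarrow> xe"
    by (rule tendsto_of_inf_compact[OF cont inf_compact _ zero
          value_along_optimal_tendsto_zero[OF nonneg fin adm opt]])
  moreover have "continuous_on UNIV J" and J_xe: "J xe = 0"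
    using feas by (auto simp: feasible_def)
  ultimately have "(\<lambda>n. J (trajectory F x u n)) \<longlonglongrightarrow> J xe"
    by (intro continuous_on_tendsto_compose[of UNIV J]) auto
  then have "(\<lambda>n. (\<Sum>k<n. c (trajectory F x u k) (u k)) + J (trajectory F x u n))
      \<longlonglongrightarrow> value_function F U c x + 0"
    using optimal_cost_sums_value_function[OF nonneg fin opt] J_xe
    by (intro tendsto_add) (simp_all add: sums_def)
  then show ?thesis
    using feasible_le_partial_cost[OF feas adm] by (intro LIMSEQ_le_const) auto
qed

lemma pairing_mono:
  assumes "\<And>x. J x \<le> J' x"
  shows "pairing \<mu> J \<le> pairing \<mu> J'"
  unfolding pairing_def using assms
  by (intro ereal_minus_mono)
     (auto simp: less_eq_ennreal.rep_eq[symmetric] intro!: nn_integral_mono ennreal_leI)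

lemma pairing_well_defined_nonneg:
  assumes "sets \<mu> = sets borel" "continuous_on UNIV J" "\<And>x. J x \<ge> 0"
  shows "pairing_well_defined \<mu> J"
proof -
  have "J \<in> borel_measurable \<mu>"
    using borel_measurable_continuous_onI[OF assms(2)] measurable_cong_sets[OF assms(1) refl]
    by blast
  moreover have "ennreal (- J x) = 0" for x
    using assms(3)[of x] by (simp add: ennreal_neg)
  ultimately show ?thesis
    by (simp add: pairing_well_defined_def)
qed

theorem proposition2p1:
  fixes F :: "'x::polish_space \<Rightarrow> 'u::polish_space \<Rightarrow> 'x"
    and U :: "'x \<Rightarrow> 'u set"
    and c :: "'x \<Rightarrow> 'u \<Rightarrow> real"
    and xe :: 'x and ue :: 'u
    and \<mu> :: "'x measure"
  assumes "\<And>x u. c x u \<ge> 0"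
    and "ue \<in> U xe" and "xe = F xe ue" and "c xe ue = 0"
    and "value_attained F U c"
    and "value_finite F U c"
    and "continuous_on UNIV (value_function F U c)"
    and "inf_compact (value_function F U c)"
    and "\<And>x. value_function F U c x = 0 \<longleftrightarrow> x = xe"
    and "sets \<mu> = sets borel"
  shows "solves_program \<mu> F U c xe (value_function F U c) (Q_function F U c)"
proof -
  let ?J = "value_function F U c"
  have "feasible F U c xe ?J (Q_function F U c)"
    using value_function_le_Q_function[OF assms(1,6)] assms(7,9)
    by (auto simp: feasible_def Q_function_def)
  moreover have "pairing_well_defined \<mu> ?J"
    by (intro pairing_well_defined_nonneg assms(7,10)) (simp add: value_function_def)
  moreover have "pairing \<mu> J \<le> pairing \<mu> ?J" if "feasible F U c xe J Q" for J Q
    by (intro pairing_mono feasible_le_value_function[OF assms(1,5-9) that])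
  ultimately show ?thesis
    by (auto simp: solves_program_def)
qed

end
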